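(* Let $S$ be a symmetry group in dimension $d$, let $(G,p)\in\mathscr{R}_{(G,S)}$ be a framework in $\mathbb{E}^d$ with $n$ joints, and let $q$ be a configuration of $n$ points in hyperbolic space $\mathbb{H}^{d}$ such that $(G,q)$ has symmetry group $S^*$ and such that the projection $\pi(q)$ from the origin onto the hyperplane $x_{d+1}=1$ and then back to $\mathbb{E}^d$ is equal to $p\in \mathbb{E}^{dn}$. Then: (i) the space of $S$-symmetric infinitesimal motions of $(G,p)$ in $\mathbb{E}^{d}$ is isomorphic to the space of $S^{*}$-symmetric infinitesimal motions of $(G,q)$ in $\mathbb{H}^{d}$; (ii) the space of $S$-symmetric trivial infinitesimal motions of $(G,p)$ in $\mathbb{E}^{d}$ is isomorphic to the space of $S^{*}$-symmetric trivial infinitesimal motions of $(G,q)$ in $\mathbb{H}^{d}$; (iii) $(G,p)$ has a non-trivial $S$-symmetric infinitesimal motion in $\mathbb{E}^{d}$ if and only if $(G,q)$ has a non-trivial $S^{*}$-symmetric infinitesimal motion in $\mathbb{H}^{d}$; (iv) the space of $S$-symmetric self-stresses of $(G,p)$ in $\mathbb{E}^{d}$ is isomorphic to the space of $S^{*}$-symmetric self-stresses of $(G,q)$ in $\mathbb{H}^{d}$.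
   Context: A framework $(G,p)$ in $\mathbb{E}^d$ is a finite simple graph $G$ with vertex set $V(G)=\{1,\dots,n\}$ and edge set $E(G)$, together with an injective map $p:V(G)\to\mathbb{E}^d$; $p_i=p(i)$. An infinitesimal motion of $(G,p)$ is a map $u:V(G)\to\mathbb{E}^d$ with $(p_i-p_j)\cdot(u_i-u_j)=0$ for all $\{i,j\}\in E(G)$. It is trivial if $u_i=Ap_i+t$ for all $i$, for some skew-symmetric matrix $A$ and vector $t$; otherwise non-trivial. A self-stress is a function $\omega:E(G)\to\mathbb{R}$ with $\sum_{j:\{i,j\}\in E(G)}\omega_{ij}(p_i-p_j)=0$ for every vertex $i$. A symmetry group in dimension $d$ is a subgroup $S$ of $O(\mathbb{E}^d)$. $\mathscr{R}_{(G,S)}$ is the set of frameworks $(G,p)$ in $\mathbb{E}^d$ for which there is a map $\Phi:S\to\mathrm{Aut}(G)$ with $x(p_i)=p_{\Phi(x)(i)}$ for all $i\in V(G)$, $x\in S$ ($\Phi$ is unique and a homomorphism since $p$ is injective); write $x(i)$ for $\Phi(x)(i)$. An infinitesimal motion $u$ is $S$-symmetric if $x(u_i)=u_{x(i)}$ for all $i$ and all $x\in S$. A self-stress is $S$-symmetric if it is constant on the orbits of edges under $S$. $\mathbb{M}^{d+1}$ is $\mathbb{R}^{d+1}$ with $\|a\|^2_{\mathbb{M}}=a_1^2+\dots+a_d^2-a_{d+1}^2$ and associated bilinear form $\langle a,b\rangle_{\mathbb{M}}=a_1b_1+\dots+a_db_d-a_{d+1}b_{d+1}$. Frameworks $(H,q)$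 in $\mathbb{M}^{d+1}$ are defined as in Euclidean space (distinct joints). An infinitesimal motion of $(H,q)$ in $\mathbb{M}^{d+1}$ is $u:V(H)\to\mathbb{R}^{d+1}$ with $\langle q_i-q_j,u_i-u_j\rangle_{\mathbb{M}}=0$ for all edges $\{i,j\}$. A self-stress is $\omega:E(H)\to\mathbb{R}$ with $\sum_{j}\omega_{ij}(\hat q_i-\hat q_j)=0$ at every vertex $i$, where $\hat a=(a_1,\dots,a_d,-a_{d+1})$. For $x\in S$ with matrix $M_x$, $x^*$ is the isometry of $\mathbb{M}^{d+1}$ with matrix $\begin{pmatrix}M_x&0\\0&1\end{pmatrix}$, and $S^*=\{x^*:x\in S\}$. $\mathscr{R}^{\mathbb{M}}_{(H,S^* )}$ and $S^*$-symmetric motions and self-stresses are defined as in the Euclidean case. Hyperbolic space $\mathbb{H}^d$ is realized on the hyper-hyperboloid $\{a\in\mathbb{M}^{d+1}:\|a\|_{\mathbb{M}}^2=-1\}$ with the metric induced from $\mathbb{M}^{d+1}$. The condition $\pi(q)=p$ means that for each $i\in V(G)$ there is a scalar $\alpha_i\ne0$ with $q_i=\alpha_i(p_i,1)$ (so necessarily $\|p_i\|<1$). A framework $(G,q)$ in $\mathbb{H}^d$ is modelled as the cone framework $(G*o,q)$ in $\mathbb{M}^{d+1}$, where $G*o$ is $G$ with a new vertex $o$ joined to all vertices of $G$ and placed at the origin: $(G,q)$ has symmetry group $S^*$ if $(G*o,q)\in\mathscr{R}^{\mathbb{M}}_{(G*o,S^* )}$; infinitesimal motions of $(G,q)$ in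 $\mathbb{H}^d$ are infinitesimal motions of $(G*o,q)$ in $\mathbb{M}^{d+1}$ with $u_o=0$, the trivial ones being $u_i=Aq_i$ with $A$ satisfying $\langle Aa,b\rangle_{\mathbb{M}}+\langle a,Ab\rangle_{\mathbb{M}}=0$ for all $a,b$; self-stresses of $(G,q)$ in $\mathbb{H}^d$ are those of $(G*o,q)$; symmetry of these is with respect to $S^*$. *)

theory Defs
  imports "HOL-Analysis.Analysis" "HOL-Algebra.Group"
begin

text \<open>
  \<open>\<bbbE>\<^sup>d\<close> is \<open>real ^ 'd\<close>.  The vertex set of a graph is a finite type \<open>'v\<close>, so that a graph is given
  by its edge set, and configurations and infinitesimal motions are elements of the vector space
  \<open>'a ^ 'v\<close>, where \<open>'a\<close> is the ambient space.
\<close>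

section \<open>Graphs\<close>

definition simple_graph :: "'v::finite set set \<Rightarrow> bool" where
  "simple_graph E \<longleftrightarrow> (\<forall>e\<in>E. card e = 2)"

definition graph_aut :: "'v::finite set set \<Rightarrow> ('v \<Rightarrow> 'v) set" where
  "graph_aut E = {f. bij f \<and> (\<forall>i j. {f i, f j} \<in> E \<longleftrightarrow> {i, j} \<in> E)}"

text \<open>The cone \<open>G * o\<close>: the new vertex \<open>o\<close> is \<open>None\<close>.\<close>

definition cone_edges :: "'v::finite set set \<Rightarrow> 'v option set set" where
  "cone_edges E = (\<lambda>e. Some ` e) ` E \<union> range (\<lambda>i. {None, Some i})"

section \<open>Symmetric frameworks\<close>

definition orthogonal_group :: "('a::real_inner \<Rightarrow> 'a) monoid" where
  "orthogonal_group = \<lparr>carrier = {x. orthogonal_transformation x}, mult = (\<circ>), one = id\<rparr>"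

lemma group_orthogonal_group: "group (orthogonal_group :: ('a::euclidean_space \<Rightarrow> 'a) monoid)"
proof (rule groupI)
  fix x :: "'a \<Rightarrow> 'a" assume "x \<in> carrier orthogonal_group"
  then have x: "orthogonal_transformation x" by (simp add: orthogonal_group_def)
  have "inv_into UNIV x \<circ> x = id"
    using orthogonal_transformation_inj[OF x] by simp
  then show "\<exists>y\<in>carrier orthogonal_group. y \<otimes>\<^bsub>orthogonal_group\<^esub> x = \<one>\<^bsub>orthogonal_group\<^esub>"
    using orthogonal_transformation_inv[OF x] by (auto simp: orthogonal_group_def)
qed (auto simp: orthogonal_group_def comp_assoc id_def
       intro: orthogonal_transformation_compose orthogonal_transformation_id)

definition framework :: "'v::finite set set \<Rightarrow> 'a ^ 'v \<Rightarrow> bool" where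
  "framework E p \<longleftrightarrow> simple_graph E \<and> inj (\<lambda>i. p $ i)"

text \<open>The set \<open>S\<close> of maps of the ambient space is left arbitrary here, so that the same notions
  apply to a subgroup of the orthogonal group and to \<open>S\<^sup>*\<close> acting on Minkowski space.\<close>

definition symmetric_frameworks :: "('a \<Rightarrow> 'a) set \<Rightarrow> 'v::finite set set \<Rightarrow> ('a ^ 'v) set" where
  "symmetric_frameworks S E = {p. framework E p \<and>
     (\<exists>\<Phi>. \<Phi> \<in> S \<rightarrow> graph_aut E \<and> (\<forall>x\<in>S. \<forall>i. x (p $ i) = p $ (\<Phi> x i)))}"

text \<open>\<open>vertex_action E p x i\<close> is \<open>x(i) = \<Phi>(x)(i)\<close>; the description is unique by the injectivity
  of \<open>p\<close>, as the lemma below records.\<close>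

definition vertex_action :: "'v::finite set set \<Rightarrow> 'a ^ 'v \<Rightarrow> ('a \<Rightarrow> 'a) \<Rightarrow> 'v \<Rightarrow> 'v" where
  "vertex_action E p x = (THE f. f \<in> graph_aut E \<and> (\<forall>i. x (p $ i) = p $ f i))"

lemma vertex_action_eq:
  assumes "framework E p" "\<Phi> \<in> S \<rightarrow> graph_aut E" "\<forall>x\<in>S. \<forall>i. x (p $ i) = p $ (\<Phi> x i)" "x \<in> S"
  shows "vertex_action E p x = \<Phi> x"
  unfolding vertex_action_def
proof (rule the_equality)
  show "\<Phi> x \<in> graph_aut E \<and> (\<forall>i. x (p $ i) = p $ \<Phi> x i)"
    using assms by auto
next
  fix f assume f: "f \<in> graph_aut E \<and> (\<forall>i. x (p $ i) = p $ f i)"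
  show "f = \<Phi> x"
  proof
    fix i
    have "p $ f i = p $ \<Phi> x i" using f assms(3,4) by metis
    then show "f i = \<Phi> x i" using assms(1) by (auto simp: framework_def dest: injD)
  qed
qed

definition edge_orbit :: "('a \<Rightarrow> 'a) set \<Rightarrow> 'v::finite set set \<Rightarrow> 'a ^ 'v \<Rightarrow> 'v set \<Rightarrow> 'v set set" where
  "edge_orbit S E p e = (\<lambda>x. vertex_action E p x ` e) ` S"

definition symmetric_motion ::
    "('a \<Rightarrow> 'a) set \<Rightarrow> 'v::finite set set \<Rightarrow> 'a ^ 'v \<Rightarrow> 'a ^ 'v \<Rightarrow> bool" where
  "symmetric_motion S E p u \<longleftrightarrow> (\<forall>x\<in>S. \<forall>i. x (u $ i) = u $ vertex_action E p x i)"

text \<open>A function \<open>E \<rightarrow> \<real>\<close> is encoded as a vector indexed by all vertex sets that vanishes outside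
  \<open>E\<close>; the vanishing is imposed in the definitions of self-stresses.\<close>

definition symmetric_stress ::
    "('a \<Rightarrow> 'a) set \<Rightarrow> 'v::finite set set \<Rightarrow> 'a ^ 'v \<Rightarrow> real ^ ('v set) \<Rightarrow> bool" where
  "symmetric_stress S E p \<omega> \<longleftrightarrow> (\<forall>e\<in>E. \<forall>e'\<in>edge_orbit S E p e. \<omega> $ e' = \<omega> $ e)"

section \<open>Euclidean space\<close>

definition euclidean_motions :: "'v::finite set set \<Rightarrow> (real ^ 'd) ^ 'v \<Rightarrow> ((real ^ 'd) ^ 'v) set" where
  "euclidean_motions E p = {u. \<forall>i j. {i, j} \<in> E \<longrightarrow> (p $ i - p $ j) \<bullet> (u $ i - u $ j) = 0}"

definition euclidean_trivial_motions ::
    "'v::finite set set \<Rightarrow> (real ^ 'd) ^ 'v \<Rightarrow> ((real ^ 'd) ^ 'v) set" where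
  "euclidean_trivial_motions E p = {u \<in> euclidean_motions E p.
     \<exists>(A :: real ^ 'd ^ 'd) t. transpose A = - A \<and> (\<forall>i. u $ i = A *v (p $ i) + t)}"

definition euclidean_stresses :: "'v::finite set set \<Rightarrow> (real ^ 'd) ^ 'v \<Rightarrow> (real ^ ('v set)) set" where
  "euclidean_stresses E p = {\<omega>. (\<forall>e. e \<notin> E \<longrightarrow> \<omega> $ e = 0) \<and>
     (\<forall>i. (\<Sum>j | {i, j} \<in> E. \<omega> $ {i, j} *\<^sub>R (p $ i - p $ j)) = 0)}"

section \<open>Minkowski space\<close>

text \<open>\<open>\<bbbM>\<^sup>d\<^sup>+\<^sup>1\<close> is \<open>(real ^ 'd) \<times> real\<close>, the second component being the coordinate of
  index \<open>d + 1\<close>.\<close>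

definition minkowski :: "(real ^ 'd) \<times> real \<Rightarrow> (real ^ 'd) \<times> real \<Rightarrow> real" where
  "minkowski a b = fst a \<bullet> fst b - snd a * snd b"

definition minkowski_hat :: "(real ^ 'd) \<times> real \<Rightarrow> (real ^ 'd) \<times> real" where
  "minkowski_hat a = (fst a, - snd a)"

definition minkowski_motions ::
    "'v::finite set set \<Rightarrow> ((real ^ 'd) \<times> real) ^ 'v \<Rightarrow> (((real ^ 'd) \<times> real) ^ 'v) set" where
  "minkowski_motions E q = {u. \<forall>i j. {i, j} \<in> E \<longrightarrow> minkowski (q $ i - q $ j) (u $ i - u $ j) = 0}"

definition minkowski_stresses ::
    "'v::finite set set \<Rightarrow> ((real ^ 'd) \<times> real) ^ 'v \<Rightarrow> (real ^ ('v set)) set" where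
  "minkowski_stresses E q = {\<omega>. (\<forall>e. e \<notin> E \<longrightarrow> \<omega> $ e = 0) \<and>
     (\<forall>i. (\<Sum>j | {i, j} \<in> E. \<omega> $ {i, j} *\<^sub>R (minkowski_hat (q $ i) - minkowski_hat (q $ j))) = 0)}"

text \<open>\<open>star x\<close> is \<open>x\<^sup>*\<close>, the map whose matrix is block diagonal with blocks \<open>M\<^sub>x\<close> and \<open>1\<close>.\<close>

definition star :: "(real ^ 'd \<Rightarrow> real ^ 'd) \<Rightarrow> (real ^ 'd) \<times> real \<Rightarrow> (real ^ 'd) \<times> real" where
  "star x = map_prod x id"

section \<open>Hyperbolic space\<close>

text \<open>Both sheets of the hyperboloid are included.\<close>

definition hyperbolic_space :: "((real ^ 'd) \<times> real) set" where
  "hyperbolic_space = {a. minkowski a a = -1}"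

definition cone_config :: "((real ^ 'd) \<times> real) ^ 'v \<Rightarrow> ((real ^ 'd) \<times> real) ^ ('v::finite option)" where
  "cone_config q = (\<chi> k. case k of None \<Rightarrow> 0 | Some i \<Rightarrow> q $ i)"

definition projects_to :: "((real ^ 'd) \<times> real) ^ 'v::finite \<Rightarrow> (real ^ 'd) ^ 'v \<Rightarrow> bool" where
  "projects_to q p \<longleftrightarrow> (\<forall>i. \<exists>\<alpha>. \<alpha> \<noteq> 0 \<and> q $ i = \<alpha> *\<^sub>R (p $ i, 1))"

definition hyperbolic_motions ::
    "'v::finite set set \<Rightarrow> ((real ^ 'd) \<times> real) ^ 'v \<Rightarrow> (((real ^ 'd) \<times> real) ^ ('v option)) set" where
  "hyperbolic_motions E q = {u \<in> minkowski_motions (cone_edges E) (cone_config q). u $ None = 0}"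

definition hyperbolic_trivial_motions ::
    "'v::finite set set \<Rightarrow> ((real ^ 'd) \<times> real) ^ 'v \<Rightarrow> (((real ^ 'd) \<times> real) ^ ('v option)) set" where
  "hyperbolic_trivial_motions E q = {u \<in> hyperbolic_motions E q.
     \<exists>A. linear A \<and> (\<forall>a b. minkowski (A a) b + minkowski a (A b) = 0) \<and>
         (\<forall>i. u $ Some i = A (q $ i))}"

definition hyperbolic_stresses ::
    "'v::finite set set \<Rightarrow> ((real ^ 'd) \<times> real) ^ 'v \<Rightarrow> (real ^ ('v option set)) set" where
  "hyperbolic_stresses E q = minkowski_stresses (cone_edges E) (cone_config q)"

section \<open>Isomorphism of linear subspaces\<close>

text \<open>Every linear map between subspaces extends linearly to the ambient space, so nothing is lost
  by taking \<open>f\<close> to be defined and linear everywhere.\<close>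

definition isomorphic_subspaces :: "'a::real_vector set \<Rightarrow> 'b::real_vector set \<Rightarrow> bool" where
  "isomorphic_subspaces U W \<longleftrightarrow>
     subspace U \<and> subspace W \<and> (\<exists>f. linear f \<and> bij_betw f U W)"

end

theory Submission imports Defs begin

text \<open>
  Write \<open>q i = \<alpha> i *\<^sub>R (p i, 1)\<close>.  Since the maps \<open>x\<^sup>*\<close> fix the last coordinate, the cone framework
  over \<open>q\<close> has the same action on the vertices of the graph as \<open>p\<close>, it fixes the cone point, and
  \<open>\<alpha>\<close> is constant on vertex orbits (\<open>central_projectionI\<close>).  Every construction below is natural in
  \<open>p\<close> and \<open>\<alpha>\<close>, hence preserves symmetry.

  A motion \<open>w\<close> of the cone framework fixing the cone point satisfies \<open>\<langle>q i, w i\<rangle> = 0\<close>, which says that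
  \<open>w i = \<alpha> i *\<^sub>R (u i, p i \<bullet> u i)\<close> for a unique \<open>u i\<close>.  For velocities of this form the Minkowski edge
  condition at \<open>{i, j}\<close> is the Euclidean one multiplied by \<open>\<alpha> i * \<alpha> j\<close> (\<open>minkowski_lift_motion\<close>), so
  \<open>u \<mapsto> w\<close> is a linear isomorphism between the spaces of motions.  It carries \<open>u i = A (p i) + t\<close>,
  with \<open>A\<close> skew, to the restriction of the block matrix \<open>(A t; t\<^sup>T 0)\<close>, and these block matrices are
  exactly the linear infinitesimal Minkowski isometries (\<open>lift_motion_trivial_iff\<close>).  So trivial motions
  correspond to trivial ones, and non-trivial to non-trivial.

  A self-stress \<open>\<omega>\<close> of \<open>p\<close> is sent to \<open>\<omega> {i, j} / (\<alpha> i * \<alpha> j)\<close> on the edges of the graph.  The resulting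
  force at \<open>q i\<close> is radial, so that a unique stress on the cone edge balances it
  (\<open>lift_stress_in\<close>, \<open>hyperbolic_stressD\<close>); equilibrium at the cone point is then automatic, because
  internal forces cancel.
\<close>

section \<open>Linear isomorphisms and cone graphs\<close>

lemma isomorphic_subspacesI:
  assumes "subspace U" "linear f" "\<And>u. u \<in> U \<Longrightarrow> f u \<in> W" "\<And>w. w \<in> W \<Longrightarrow> g w \<in> U"
    and "\<And>u. u \<in> U \<Longrightarrow> g (f u) = u" "\<And>w. w \<in> W \<Longrightarrow> f (g w) = w"
  shows "isomorphic_subspaces U W"
proof -
  have bij: "bij_betw f U W"
    by (rule bij_betw_byWitness[where f' = g]) (use assms in auto)
  then have "W = f ` U" by (simp add: bij_betw_def)
  then have "subspace W" using assms(1,2) by (simp add: linear_subspace_image)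
  then show ?thesis using assms(1,2) bij by (auto simp: isomorphic_subspaces_def)
qed

lemma sum_UNIV_option:
  "(\<Sum>k\<in>(UNIV :: 'v::finite option set). f k) = f None + (\<Sum>i\<in>UNIV. f (Some i))"
  by (simp add: UNIV_option_conv sum.reindex)

lemma Some_image_in_cone_edges [simp]: "Some ` e \<in> cone_edges E \<longleftrightarrow> e \<in> E"
  by (auto simp: cone_edges_def inj_image_eq_iff)

lemma Some_edge_in_cone_edges [simp]: "{Some i, Some j} \<in> cone_edges E \<longleftrightarrow> {i, j} \<in> E"
  using Some_image_in_cone_edges[of "{i, j}" E] by (simp del: Some_image_in_cone_edges)

lemma ball_cone_edges:
  "(\<forall>e\<in>cone_edges E. P e) \<longleftrightarrow> (\<forall>e\<in>E. P (Some ` e)) \<and> (\<forall>i. P {None, Some i})"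
  by (auto simp: cone_edges_def)

lemma cone_edge_in_cone_edges [simp]:
  "{None, Some i} \<in> cone_edges E" "{Some i, None} \<in> cone_edges E"
  by (auto simp: cone_edges_def insert_commute)

lemma cone_config_simps [simp]: "cone_config q $ None = 0" "cone_config q $ Some i = q $ i"
  by (simp_all add: cone_config_def)

text \<open>An antisymmetric array has total sum zero: internal forces cancel.\<close>

lemma sum_antisymmetric:
  fixes F :: "'v::finite \<Rightarrow> 'v \<Rightarrow> 'a::real_vector"
  assumes "\<And>i j. F i j = - F j i"
  shows "(\<Sum>i\<in>UNIV. \<Sum>j\<in>UNIV. F i j) = 0"
proof -
  have "(\<Sum>i\<in>UNIV. \<Sum>j\<in>UNIV. F i j) = (\<Sum>j\<in>UNIV. \<Sum>i\<in>UNIV. F i j)"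
    by (rule sum.swap)
  also have "\<dots> = - (\<Sum>j\<in>UNIV. \<Sum>i\<in>UNIV. F j i)"
    by (subst assms) (simp add: sum_negf)
  finally have "2 *\<^sub>R (\<Sum>i\<in>UNIV. \<Sum>j\<in>UNIV. F i j) = 0"
    by (simp add: scaleR_2 eq_neg_iff_add_eq_0)
  then show ?thesis by simp
qed

lemma euclidean_stresses_iff:
  "\<omega> \<in> euclidean_stresses E p \<longleftrightarrow> (\<forall>e. e \<notin> E \<longrightarrow> \<omega> $ e = 0) \<and>
     (\<forall>i. (\<Sum>j\<in>UNIV. \<omega> $ {i, j} *\<^sub>R (p $ i - p $ j)) = 0)"
proof -
  have "(\<Sum>j | {i, j} \<in> E. \<omega> $ {i, j} *\<^sub>R (p $ i - p $ j))
      = (\<Sum>j\<in>UNIV. \<omega> $ {i, j} *\<^sub>R (p $ i - p $ j))"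
    if "\<forall>e. e \<notin> E \<longrightarrow> \<omega> $ e = 0" for i
    by (rule sum.mono_neutral_left) (use that in auto)
  then show ?thesis by (auto simp: euclidean_stresses_def)
qed

text \<open>
  The change of sign in the last coordinate is irrelevant for equilibrium.  The first condition on
  the forces is equilibrium at the joints of the graph, the second at the cone point.
\<close>

lemma hyperbolic_stresses_iff:
  "\<omega> \<in> hyperbolic_stresses E q \<longleftrightarrow> (\<forall>e. e \<notin> cone_edges E \<longrightarrow> \<omega> $ e = 0) \<and>
     (\<forall>i. \<omega> $ {Some i, None} *\<^sub>R q $ i
        + (\<Sum>j\<in>UNIV. \<omega> $ (Some ` {i, j}) *\<^sub>R (q $ i - q $ j)) = 0) \<and>
     (\<Sum>i\<in>UNIV. \<omega> $ {Some i, None} *\<^sub>R q $ i) = 0"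
  (is "?L \<longleftrightarrow> ?Z \<and> ?A \<and> ?B")
proof (cases ?Z)
  case True
  let ?c = "cone_config q"
  have ext: "(\<Sum>l | {k, l} \<in> cone_edges E. \<omega> $ {k, l} *\<^sub>R (minkowski_hat (?c $ k) - minkowski_hat (?c $ l)))
      = minkowski_hat (\<Sum>l\<in>UNIV. \<omega> $ {k, l} *\<^sub>R (?c $ k - ?c $ l))" for k
  proof -
    have "(\<Sum>l | {k, l} \<in> cone_edges E. \<omega> $ {k, l} *\<^sub>R (minkowski_hat (?c $ k) - minkowski_hat (?c $ l)))
      = (\<Sum>l\<in>UNIV. \<omega> $ {k, l} *\<^sub>R (minkowski_hat (?c $ k) - minkowski_hat (?c $ l)))"
      by (rule sum.mono_neutral_left) (use True in auto)
    also have "\<dots> = minkowski_hat (\<Sum>l\<in>UNIV. \<omega> $ {k, l} *\<^sub>R (?c $ k - ?c $ l))"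
      by (simp add: minkowski_hat_def prod_eq_iff fst_sum snd_sum flip: sum_negf)
         (simp add: algebra_simps)
    finally show ?thesis .
  qed
  have hat0: "minkowski_hat a = 0 \<longleftrightarrow> a = 0" for a :: "(real ^ 'd) \<times> real"
    by (simp add: minkowski_hat_def prod_eq_iff)
  have "?L \<longleftrightarrow> (\<forall>k. (\<Sum>l\<in>UNIV. \<omega> $ {k, l} *\<^sub>R (?c $ k - ?c $ l)) = 0)"
    using True by (simp only: hyperbolic_stresses_def minkowski_stresses_def mem_Collect_eq ext hat0) simp
  also have "\<dots> \<longleftrightarrow> ?A \<and> ?B"
  proof -
    have "(\<Sum>l\<in>UNIV. \<omega> $ {None, l} *\<^sub>R (?c $ None - ?c $ l))
        = - (\<Sum>i\<in>UNIV. \<omega> $ {Some i, None} *\<^sub>R q $ i)"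
      by (simp add: sum_UNIV_option sum_negf insert_commute)
    moreover have "(\<Sum>l\<in>UNIV. \<omega> $ {Some i, l} *\<^sub>R (?c $ Some i - ?c $ l))
        = \<omega> $ {Some i, None} *\<^sub>R q $ i + (\<Sum>j\<in>UNIV. \<omega> $ (Some ` {i, j}) *\<^sub>R (q $ i - q $ j))" for i
      by (simp add: sum_UNIV_option)
    ultimately show ?thesis
      by (subst split_option_all) auto
  qed
  finally show ?thesis using True by blast
next
  case False
  then show ?thesis by (auto simp: hyperbolic_stresses_def minkowski_stresses_def)
qed

section \<open>Central projection of a symmetric framework\<close>

text \<open>
  The situation of a Euclidean framework \<open>p\<close> and a framework \<open>q\<close> in Minkowski space lying over it
  under central projection, with heights \<open>\<alpha>\<close>; \<open>\<phi> x\<close> is the permutation of the vertices induced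
  by \<open>x \<in> S\<close>.  The two frameworks share the vertex action, and \<open>\<alpha>\<close> is constant on vertex orbits.
\<close>

locale central_projection =
  fixes S :: "(real ^ 'd \<Rightarrow> real ^ 'd) set"
    and E :: "'v::finite set set"
    and p :: "(real ^ 'd) ^ 'v"
    and q :: "((real ^ 'd) \<times> real) ^ 'v"
    and \<alpha> :: "'v \<Rightarrow> real"
    and \<phi> :: "(real ^ 'd \<Rightarrow> real ^ 'd) \<Rightarrow> 'v \<Rightarrow> 'v"
  assumes simple: "simple_graph E"
    and orth: "x \<in> S \<Longrightarrow> orthogonal_transformation x"
    and aut: "x \<in> S \<Longrightarrow> \<phi> x \<in> graph_aut E"
    and equivariant: "x \<in> S \<Longrightarrow> x (p $ i) = p $ \<phi> x i"
    and action: "x \<in> S \<Longrightarrow> vertex_action E p x = \<phi> x"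
    and cone_action:
      "x \<in> S \<Longrightarrow> vertex_action (cone_edges E) (cone_config q) (star x) = map_option (\<phi> x)"
    and q_eq: "q $ i = \<alpha> i *\<^sub>R (p $ i, 1)"
    and \<alpha>_nonzero [simp]: "\<alpha> i \<noteq> 0"
    and \<alpha>_invariant [simp]: "x \<in> S \<Longrightarrow> \<alpha> (\<phi> x i) = \<alpha> i"
begin

lemma loop_notin [simp]: "{i} \<notin> E"
  using simple by (auto simp: simple_graph_def)

lemma bij_\<phi>: "x \<in> S \<Longrightarrow> bij (\<phi> x)"
  using aut by (auto simp: graph_aut_def)

lemma linear_S: "x \<in> S \<Longrightarrow> linear x"
  using orth by (simp add: orthogonal_transformation_linear)

lemma euclidean_symmetric_iff:
  "symmetric_motion S E p u \<longleftrightarrow> (\<forall>x\<in>S. \<forall>i. x (u $ i) = u $ \<phi> x i)"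
  by (simp add: symmetric_motion_def action)

lemma hyperbolic_symmetric_iff:
  assumes "u $ None = 0"
  shows "symmetric_motion (star ` S) (cone_edges E) (cone_config q) u \<longleftrightarrow>
    (\<forall>x\<in>S. \<forall>i. x (fst (u $ Some i)) = fst (u $ Some (\<phi> x i))
       \<and> snd (u $ Some i) = snd (u $ Some (\<phi> x i)))"
proof -
  have "x 0 = 0" if "x \<in> S" for x using linear_0[OF linear_S[OF that]] .
  then have "(\<forall>k. star x (u $ k) = u $ map_option (\<phi> x) k) \<longleftrightarrow>
      (\<forall>i. x (fst (u $ Some i)) = fst (u $ Some (\<phi> x i))
        \<and> snd (u $ Some i) = snd (u $ Some (\<phi> x i)))" if "x \<in> S" for x
    using that assms by (simp add: split_option_all star_def prod_eq_iff)
  then show ?thesis by (simp add: symmetric_motion_def cone_action)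
qed

section \<open>Infinitesimal motions\<close>

text \<open>
  A velocity \<open>u i\<close> at \<open>p i\<close> is scaled by \<open>\<alpha> i\<close>; the last component is then forced by the
  requirement that the velocity be Minkowski-orthogonal to \<open>q i\<close>, that is, by the cone edge at \<open>i\<close>.
\<close>

definition lift_motion :: "(real ^ 'd) ^ 'v \<Rightarrow> ((real ^ 'd) \<times> real) ^ 'v option" where
  "lift_motion u = (\<chi> k. case k of None \<Rightarrow> 0 | Some i \<Rightarrow> \<alpha> i *\<^sub>R (u $ i, p $ i \<bullet> u $ i))"

text \<open>The inverse on motions of the cone framework: rescale and forget the last component.\<close>

definition project_motion :: "((real ^ 'd) \<times> real) ^ 'v option \<Rightarrow> (real ^ 'd) ^ 'v" where
  "project_motion u = (\<chi> i. fst (u $ Some i) /\<^sub>R \<alpha> i)"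

lemma lift_motion_simps [simp]:
  "lift_motion u $ None = 0" "lift_motion u $ Some i = \<alpha> i *\<^sub>R (u $ i, p $ i \<bullet> u $ i)"
  by (simp_all add: lift_motion_def)

lemma project_motion_simps [simp]: "project_motion u $ i = fst (u $ Some i) /\<^sub>R \<alpha> i"
  by (simp add: project_motion_def)

lemma linear_lift_motion: "linear lift_motion"
  by (rule linearI) (simp_all add: vec_eq_iff split_option_all algebra_simps)

lemma project_lift_motion: "project_motion (lift_motion u) = u"
  by (simp add: vec_eq_iff)

lemma minkowski_lift_motion:
  "minkowski (q $ i - q $ j) (lift_motion u $ Some i - lift_motion u $ Some j)
    = \<alpha> i * \<alpha> j * ((p $ i - p $ j) \<bullet> (u $ i - u $ j))"
  by (simp add: minkowski_def q_eq algebra_simps)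

lemma hyperbolic_motions_iff:
  "w \<in> hyperbolic_motions E q \<longleftrightarrow> w $ None = 0
     \<and> (\<forall>i. minkowski (q $ i) (w $ Some i) = 0)
     \<and> (\<forall>i j. {i, j} \<in> E \<longrightarrow> minkowski (q $ i - q $ j) (w $ Some i - w $ Some j) = 0)"
  by (auto simp: hyperbolic_motions_def minkowski_motions_def split_option_all minkowski_def)

lemma lift_motion_in_iff: "lift_motion u \<in> hyperbolic_motions E q \<longleftrightarrow> u \<in> euclidean_motions E p"
proof -
  have "minkowski (q $ i) (lift_motion u $ Some i) = 0" for i
    by (simp add: minkowski_def q_eq)
  then show ?thesis
    unfolding hyperbolic_motions_iff minkowski_lift_motion by (simp add: euclidean_motions_def)
qed

lemma lift_project_motion:
  assumes "w \<in> hyperbolic_motions E q"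
  shows "lift_motion (project_motion w) = w"
proof -
  have "p $ i \<bullet> fst (w $ Some i) = snd (w $ Some i)" for i
  proof -
    have "minkowski (q $ i) (w $ Some i) = 0" "w $ None = 0"
      using assms by (auto simp: hyperbolic_motions_iff)
    then have "\<alpha> i * (p $ i \<bullet> fst (w $ Some i) - snd (w $ Some i)) = 0"
      by (simp add: minkowski_def q_eq algebra_simps)
    then show ?thesis by simp
  qed
  moreover have "w $ None = 0" using assms by (simp add: hyperbolic_motions_iff)
  ultimately show ?thesis
    by (simp add: vec_eq_iff split_option_all prod_eq_iff)
qed

lemma lift_motion_symmetric_iff:
  "symmetric_motion (star ` S) (cone_edges E) (cone_config q) (lift_motion u)
    \<longleftrightarrow> symmetric_motion S E p u"
proof -
  have "p $ i \<bullet> u $ i = p $ \<phi> x i \<bullet> u $ \<phi> x i" if "x \<in> S" "x (u $ i) = u $ \<phi> x i" for x i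
    using orth[OF that(1)] equivariant[OF that(1), of i] that(2)
    by (metis orthogonal_transformation_def)
  moreover have "x (\<alpha> i *\<^sub>R u $ i) = \<alpha> i *\<^sub>R x (u $ i)" if "x \<in> S" for x i
    using linear_cmul[OF linear_S[OF that]] .
  ultimately show ?thesis
    by (simp add: hyperbolic_symmetric_iff euclidean_symmetric_iff cong: ball_cong)
       (metis \<alpha>_nonzero scaleR_left_imp_eq)
qed

text \<open>
  The infinitesimal linear isometries of Minkowski space are the maps with block matrix
  \<open>(A t; t\<^sup>T 0)\<close> with \<open>A\<close> skew, and these correspond to the infinitesimal Euclidean isometries
  \<open>a \<mapsto> A a + t\<close>.
\<close>

lemma lift_motion_trivial_iff:
  "lift_motion u \<in> hyperbolic_trivial_motions E q \<longleftrightarrow> u \<in> euclidean_trivial_motions E p"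
proof
  assume "u \<in> euclidean_trivial_motions E p"
  then obtain A :: "real ^ 'd ^ 'd" and t where u: "u \<in> euclidean_motions E p"
    and A: "transpose A = - A" and ut: "\<And>i. u $ i = A *v (p $ i) + t"
    by (auto simp: euclidean_trivial_motions_def)
  have skew: "(A *v a) \<bullet> b = - (a \<bullet> (A *v b))" for a b
  proof -
    have "(A *v a) \<bullet> b = a \<bullet> (transpose A *v b)"
      by (metis dot_lmul_matrix inner_commute transpose_matrix_vector)
    also have "transpose A *v b = - (A *v b)"
      by (simp add: A matrix_vector_mult_def vec_eq_iff sum_negf)
    finally show ?thesis by simp
  qed
  \<comment> \<open>the block matrix \<open>(A t; t\<^sup>T 0)\<close>\<close>
  let ?B = "\<lambda>a :: (real ^ 'd) \<times> real. (A *v fst a + snd a *\<^sub>R t, t \<bullet> fst a)"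
  have "linear ?B"
    by (rule linearI) (simp_all add: algebra_simps matrix_vector_right_distrib
        matrix_vector_mult_scaleR)
  moreover have "minkowski (?B a) b + minkowski a (?B b) = 0" for a b
    using skew[of "fst a" "fst b"]
    by (simp add: minkowski_def algebra_simps inner_commute)
  moreover have "lift_motion u $ Some i = ?B (q $ i)" for i
    using skew[of "p $ i" "p $ i"]
    by (simp add: q_eq ut algebra_simps matrix_vector_mult_scaleR inner_commute)
  ultimately show "lift_motion u \<in> hyperbolic_trivial_motions E q"
    unfolding hyperbolic_trivial_motions_def using u lift_motion_in_iff by blast
next
  assume "lift_motion u \<in> hyperbolic_trivial_motions E q"
  then obtain B where u: "u \<in> euclidean_motions E p" and lin: "linear B"
    and B: "\<And>a b. minkowski (B a) b + minkowski a (B b) = 0"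
    and Bu: "\<And>i. lift_motion u $ Some i = B (q $ i)"
    unfolding hyperbolic_trivial_motions_def using lift_motion_in_iff by blast
  \<comment> \<open>the blocks of \<open>B\<close>: its skew part and its translation part\<close>
  let ?f = "\<lambda>a. fst (B (a, 0))" and ?t = "fst (B (0, 1))"
  have lf: "linear ?f"
  proof (rule linearI)
    show "?f (a + b) = ?f a + ?f b" for a b
      using linear_add[OF lin, of "(a, 0)" "(b, 0)"] by simp
    show "?f (c *\<^sub>R a) = c *\<^sub>R ?f a" for c a
      using linear_scale[OF lin, of c "(a, 0)"] by simp
  qed
  have skew: "?f a \<bullet> b + a \<bullet> ?f b = 0" for a b
    using B[of "(a, 0)" "(b, 0)"] by (simp add: minkowski_def)
  have "adjoint ?f = (\<lambda>a. - ?f a)"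
    by (rule adjoint_unique) (use skew in \<open>simp add: add_eq_0_iff2\<close>)
  then have "transpose (matrix ?f) = matrix (\<lambda>a. - ?f a)"
    using matrix_adjoint[OF lf] by simp
  also have "\<dots> = - matrix ?f"
    by (simp add: matrix_def vec_eq_iff)
  finally have A: "transpose (matrix ?f) = - matrix ?f" .
  have "u $ i = matrix ?f *v (p $ i) + ?t" for i
  proof -
    have "B (q $ i) = \<alpha> i *\<^sub>R (B (p $ i, 0) + B (0, 1))"
      unfolding q_eq linear_scale[OF lin]
      using linear_add[OF lin, of "(p $ i, 0)" "(0, 1)"] by simp
    then have "\<alpha> i *\<^sub>R u $ i = \<alpha> i *\<^sub>R (?f (p $ i) + ?t)"
      using Bu[of i] by (simp add: prod_eq_iff)
    then show ?thesis using matrix_vector_mul(2)[OF lf] by (simp add: fun_eq_iff)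
  qed
  then show "u \<in> euclidean_trivial_motions E p"
    unfolding euclidean_trivial_motions_def using u A by blast
qed

lemma subspace_euclidean_motions:
  "subspace {u \<in> euclidean_motions E p. symmetric_motion S E p u}"
proof -
  have "subspace (euclidean_motions E p)"
    by (auto simp: subspace_def euclidean_motions_def inner_add_right add_diff_add
        simp flip: scaleR_diff_right)
  moreover have "subspace {u. \<forall>i. x (u $ i) = u $ \<phi> x i}" if "x \<in> S" for x
    using linear_S[OF that] by (simp add: subspace_def linear_0 linear_add linear_cmul)
  then have "subspace (\<Inter>x\<in>S. {u. \<forall>i. x (u $ i) = u $ \<phi> x i})" by (auto intro: subspace_Inter)
  moreover have "{u \<in> euclidean_motions E p. symmetric_motion S E p u}
      = euclidean_motions E p \<inter> (\<Inter>x\<in>S. {u. \<forall>i. x (u $ i) = u $ \<phi> x i})"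
    by (auto simp: euclidean_symmetric_iff)
  ultimately show ?thesis by (simp add: subspace_inter)
qed

lemma subspace_euclidean_trivial_motions:
  "subspace {u \<in> euclidean_trivial_motions E p. symmetric_motion S E p u}"
proof -
  let ?T = "{u. \<exists>(A :: real ^ 'd ^ 'd) t. transpose A = - A \<and> (\<forall>i. u $ i = A *v (p $ i) + t)}"
  have "subspace ?T"
    unfolding subspace_def
  proof (intro conjI ballI allI)
    have "transpose (0 :: real ^ 'd ^ 'd) = - 0" by (simp add: transpose_def vec_eq_iff)
    moreover have "(0 :: (real ^ 'd) ^ 'v) $ i = (0 :: real ^ 'd ^ 'd) *v (p $ i) + 0" for i by simp
    ultimately show "0 \<in> ?T" by blast
    fix u assume "u \<in> ?T"
    then obtain A :: "real ^ 'd ^ 'd" and t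
      where A: "transpose A = - A" "\<And>i. u $ i = A *v (p $ i) + t" by blast
    have "transpose (c *\<^sub>R A) = - (c *\<^sub>R A)" for c
    proof -
      have "transpose (c *\<^sub>R A) = c *\<^sub>R transpose A" by (simp add: transpose_def vec_eq_iff)
      then show ?thesis by (simp add: A(1))
    qed
    moreover have "(c *\<^sub>R u) $ i = (c *\<^sub>R A) *v (p $ i) + c *\<^sub>R t" for c i
      by (simp add: A(2) scaleR_add_right scaleR_matrix_vector_assoc)
    ultimately show "c *\<^sub>R u \<in> ?T" for c by blast
    fix v assume "v \<in> ?T"
    then obtain B :: "real ^ 'd ^ 'd" and s
      where B: "transpose B = - B" "\<And>i. v $ i = B *v (p $ i) + s" by blast
    have "transpose (A + B) = transpose A + transpose B" by (simp add: transpose_def vec_eq_iff)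
    then have "transpose (A + B) = - (A + B)" by (simp add: A(1) B(1))
    moreover have "(u + v) $ i = (A + B) *v (p $ i) + (t + s)" for i
      by (simp add: A(2) B(2) matrix_vector_mult_add_rdistrib)
    ultimately show "u + v \<in> ?T" by blast
  qed
  moreover have "{u \<in> euclidean_trivial_motions E p. symmetric_motion S E p u}
      = {u \<in> euclidean_motions E p. symmetric_motion S E p u} \<inter> ?T"
    by (auto simp: euclidean_trivial_motions_def)
  ultimately show ?thesis by (simp add: subspace_inter subspace_euclidean_motions)
qed

lemma hyperbolic_trivial_subset: "hyperbolic_trivial_motions E q \<subseteq> hyperbolic_motions E q"
  by (auto simp: hyperbolic_trivial_motions_def)

lemma isomorphic_motions:
  "isomorphic_subspaces {u \<in> euclidean_motions E p. symmetric_motion S E p u}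
     {u \<in> hyperbolic_motions E q. symmetric_motion (star ` S) (cone_edges E) (cone_config q) u}"
proof (rule isomorphic_subspacesI[where f = lift_motion and g = project_motion,
      OF subspace_euclidean_motions linear_lift_motion], goal_cases)
  case (2 w)
  then show ?case
    using lift_project_motion[of w] lift_motion_in_iff[of "project_motion w"]
      lift_motion_symmetric_iff[of "project_motion w"] by simp
qed (auto simp: lift_motion_in_iff lift_motion_symmetric_iff project_lift_motion lift_project_motion)

lemma isomorphic_trivial_motions:
  "isomorphic_subspaces {u \<in> euclidean_trivial_motions E p. symmetric_motion S E p u}
     {u \<in> hyperbolic_trivial_motions E q.
        symmetric_motion (star ` S) (cone_edges E) (cone_config q) u}"
proof (rule isomorphic_subspacesI[where f = lift_motion and g = project_motion,
      OF subspace_euclidean_trivial_motions linear_lift_motion], goal_cases)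
  case (2 w)
  then show ?case
    using lift_project_motion[of w] lift_motion_trivial_iff[of "project_motion w"]
      lift_motion_symmetric_iff[of "project_motion w"] hyperbolic_trivial_subset by auto
next
  case (4 w)
  then show ?case using hyperbolic_trivial_subset lift_project_motion by auto
qed (auto simp: lift_motion_trivial_iff lift_motion_symmetric_iff project_lift_motion)

lemma nontrivial_motion_iff:
  "(\<exists>u \<in> euclidean_motions E p. symmetric_motion S E p u \<and> u \<notin> euclidean_trivial_motions E p)
    \<longleftrightarrow> (\<exists>u \<in> hyperbolic_motions E q.
          symmetric_motion (star ` S) (cone_edges E) (cone_config q) u
          \<and> u \<notin> hyperbolic_trivial_motions E q)"
  by (metis lift_motion_in_iff lift_motion_symmetric_iff lift_motion_trivial_iff
      lift_project_motion)

section \<open>Self-stresses\<close>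

text \<open>
  The stress on an edge of \<open>G\<close> is divided by the heights of its end points; the stress on the
  cone edge at \<open>i\<close> is the one that balances the resulting radial force at \<open>q i\<close>.  The sum
  over the \<open>i\<close> with \<open>e = {None, Some i}\<close> has at most one term.
\<close>

definition radial_stress :: "real ^ ('v set) \<Rightarrow> 'v \<Rightarrow> real" where
  "radial_stress \<omega> i = (\<Sum>j\<in>UNIV. \<omega> $ {i, j} * (1 / \<alpha> i - 1 / \<alpha> j)) / \<alpha> i"

definition lift_stress :: "real ^ ('v set) \<Rightarrow> real ^ ('v option set)" where
  "lift_stress \<omega> = (\<chi> e. if None \<in> e then (\<Sum>i | e = {None, Some i}. radial_stress \<omega> i)
     else \<omega> $ (Some -` e) / (\<Prod>i\<in>Some -` e. \<alpha> i))"

text \<open>The inverse on self-stresses: rescale and forget the stresses on the cone edges.\<close>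

definition project_stress :: "real ^ ('v option set) \<Rightarrow> real ^ ('v set)" where
  "project_stress \<omega> = (\<chi> e. \<omega> $ (Some ` e) * (\<Prod>i\<in>e. \<alpha> i))"

lemma lift_stress_Some [simp]: "lift_stress \<omega> $ (Some ` e) = \<omega> $ e / (\<Prod>i\<in>e. \<alpha> i)"
  by (auto simp: lift_stress_def inj_vimage_image_eq)

lemma lift_stress_None [simp]:
  "lift_stress \<omega> $ {Some i, None} = radial_stress \<omega> i"
  "lift_stress \<omega> $ {None, Some i} = radial_stress \<omega> i"
proof -
  have *: "{j. {None, Some i} = {None, Some j}} = {i}" for i :: 'v by (auto simp: doubleton_eq_iff)
  show "lift_stress \<omega> $ {None, Some i} = radial_stress \<omega> i" by (simp add: lift_stress_def *)
  then show "lift_stress \<omega> $ {Some i, None} = radial_stress \<omega> i" by (simp add: insert_commute)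
qed

lemma project_stress_simps [simp]: "project_stress \<omega> $ e = \<omega> $ (Some ` e) * (\<Prod>i\<in>e. \<alpha> i)"
  by (simp add: project_stress_def)

lemma linear_lift_stress: "linear lift_stress"
proof -
  have "radial_stress (\<omega> + \<omega>') i = radial_stress \<omega> i + radial_stress \<omega>' i" for \<omega> \<omega>' i
    by (simp add: radial_stress_def distrib_right sum.distrib add_divide_distrib)
  moreover have "radial_stress (c *\<^sub>R \<omega>) i = c * radial_stress \<omega> i" for c \<omega> i
    by (simp add: radial_stress_def sum_distrib_left mult.assoc)
  ultimately show ?thesis
    by (intro linearI) (simp_all add: vec_eq_iff lift_stress_def sum.distrib add_divide_distrib
        sum_distrib_left)
qed

lemma project_lift_stress: "project_stress (lift_stress \<omega>) = \<omega>"
  by (simp add: vec_eq_iff)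

lemma prod_edge: "{i, j} \<in> E \<Longrightarrow> (\<Prod>k\<in>{i, j}. \<alpha> k) = \<alpha> i * \<alpha> j"
  by (cases "i = j") auto

lemma scaled_stress:
  assumes "\<forall>e. e \<notin> E \<longrightarrow> \<omega> $ e = 0"
  shows "\<omega> $ {i, j} * (\<Prod>k\<in>{i, j}. \<alpha> k) = \<omega> $ {i, j} * (\<alpha> i * \<alpha> j)"
    and "\<omega> $ {i, j} / (\<Prod>k\<in>{i, j}. \<alpha> k) = \<omega> $ {i, j} / (\<alpha> i * \<alpha> j)"
  using assms prod_edge by (cases "{i, j} \<in> E"; simp)+

lemma lift_stress_in:
  assumes "\<omega> \<in> euclidean_stresses E p"
  shows "lift_stress \<omega> \<in> hyperbolic_stresses E q"
proof -
  have off: "\<forall>e. e \<notin> E \<longrightarrow> \<omega> $ e = 0"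
    and eq: "\<And>i. (\<Sum>j\<in>UNIV. \<omega> $ {i, j} *\<^sub>R (p $ i - p $ j)) = 0"
    using assms by (auto simp: euclidean_stresses_iff)
  have off': "lift_stress \<omega> $ e = 0" if "e \<notin> cone_edges E" for e
  proof (cases "None \<in> e")
    case True
    have "{i. e = {None, Some i}} = {}" using that by auto
    with True show ?thesis by (simp add: lift_stress_def)
  next
    case False
    then have "e = Some ` (Some -` e)" by (auto simp: image_iff) (metis not_None_eq)
    with that off show ?thesis
      by (metis Some_image_in_cone_edges div_0 lift_stress_Some)
  qed
  have joint: "lift_stress \<omega> $ {Some i, None} *\<^sub>R q $ i
      + (\<Sum>j\<in>UNIV. lift_stress \<omega> $ (Some ` {i, j}) *\<^sub>R (q $ i - q $ j)) = 0" for i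
  proof -
    \<comment> \<open>The force along an edge splits into a radial part and a multiple of the Euclidean force.\<close>
    have "lift_stress \<omega> $ (Some ` {i, j}) *\<^sub>R (q $ i - q $ j)
        = (\<omega> $ {i, j} * (1 / \<alpha> j - 1 / \<alpha> i)) *\<^sub>R (p $ i, 1)
          + (1 / \<alpha> i) *\<^sub>R (\<omega> $ {i, j} *\<^sub>R (p $ i - p $ j), 0)" for j
      unfolding lift_stress_Some scaled_stress(2)[OF off]
      by (simp add: q_eq prod_eq_iff algebra_simps) (simp add: field_simps flip: scaleR_add_left)
    then have "(\<Sum>j\<in>UNIV. lift_stress \<omega> $ (Some ` {i, j}) *\<^sub>R (q $ i - q $ j))
        = (\<Sum>j\<in>UNIV. \<omega> $ {i, j} * (1 / \<alpha> j - 1 / \<alpha> i)) *\<^sub>R (p $ i, 1)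
          + (1 / \<alpha> i) *\<^sub>R (\<Sum>j\<in>UNIV. (\<omega> $ {i, j} *\<^sub>R (p $ i - p $ j), 0))"
      by (simp only: sum.distrib scaleR_sum_left scaleR_sum_right)
    also have "(\<Sum>j\<in>UNIV. (\<omega> $ {i, j} *\<^sub>R (p $ i - p $ j), 0 :: real)) = 0"
      using eq[of i] by (simp add: prod_eq_iff fst_sum snd_sum)
    also have "(\<Sum>j\<in>UNIV. \<omega> $ {i, j} * (1 / \<alpha> j - 1 / \<alpha> i)) = - (radial_stress \<omega> i * \<alpha> i)"
      by (simp add: radial_stress_def right_diff_distrib sum_subtractf)
    finally have force: "(\<Sum>j\<in>UNIV. lift_stress \<omega> $ (Some ` {i, j}) *\<^sub>R (q $ i - q $ j))
        = - (radial_stress \<omega> i * \<alpha> i) *\<^sub>R (p $ i, 1)" by simp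
    show ?thesis unfolding force by (simp add: q_eq zero_prod_def)
  qed
  \<comment> \<open>Equilibrium at the cone point follows by adding up the equilibria at all other joints.\<close>
  have "(\<Sum>i\<in>UNIV. lift_stress \<omega> $ {Some i, None} *\<^sub>R q $ i)
      = - (\<Sum>i\<in>UNIV. \<Sum>j\<in>UNIV. lift_stress \<omega> $ (Some ` {i, j}) *\<^sub>R (q $ i - q $ j))"
    using joint by (simp add: eq_neg_iff_add_eq_0 flip: sum.distrib)
  also have "(\<Sum>i\<in>UNIV. \<Sum>j\<in>UNIV. lift_stress \<omega> $ (Some ` {i, j}) *\<^sub>R (q $ i - q $ j)) = 0"
    by (rule sum_antisymmetric) (simp add: insert_commute algebra_simps)
  finally show ?thesis
    unfolding hyperbolic_stresses_iff using joint off' by simp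
qed

lemma hyperbolic_stressD:
  assumes "\<omega> \<in> hyperbolic_stresses E q"
  shows "project_stress \<omega> \<in> euclidean_stresses E p"
    and "lift_stress (project_stress \<omega>) = \<omega>"
proof -
  let ?\<omega> = "project_stress \<omega>"
  have off: "\<And>e. e \<notin> cone_edges E \<Longrightarrow> \<omega> $ e = 0"
    and joint: "\<And>i. \<omega> $ {Some i, None} *\<^sub>R q $ i
        + (\<Sum>j\<in>UNIV. \<omega> $ (Some ` {i, j}) *\<^sub>R (q $ i - q $ j)) = 0"
    using assms by (auto simp: hyperbolic_stresses_iff)
  have off': "\<forall>e. e \<notin> E \<longrightarrow> ?\<omega> $ e = 0" using off by simp
  have offi: "\<forall>e. e \<notin> E \<longrightarrow> (\<chi> e. \<omega> $ (Some ` e)) $ e = 0" using off by simp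
  have scaled: "?\<omega> $ {i, j} = \<omega> $ (Some ` {i, j}) * (\<alpha> i * \<alpha> j)" for i j
    using scaled_stress(1)[OF offi, of i j] by simp
  \<comment> \<open>The last coordinate of the equilibrium condition determines the stress on the cone edge.\<close>
  have last: "\<omega> $ {Some i, None} * \<alpha> i = (\<Sum>j\<in>UNIV. \<omega> $ (Some ` {i, j}) * (\<alpha> j - \<alpha> i))" for i
    using arg_cong[OF joint[of i], of snd]
    by (simp add: snd_sum q_eq right_diff_distrib sum_subtractf del: image_insert)
  have "(\<Sum>j\<in>UNIV. ?\<omega> $ {i, j} *\<^sub>R (p $ i - p $ j)) = 0" for i
  proof -
    have "0 = (\<omega> $ {Some i, None} * \<alpha> i) *\<^sub>R p $ i
        + (\<Sum>j\<in>UNIV. \<omega> $ (Some ` {i, j}) *\<^sub>R (\<alpha> i *\<^sub>R p $ i - \<alpha> j *\<^sub>R p $ j))"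
      using arg_cong[OF joint[of i], of fst] by (simp add: fst_sum q_eq del: image_insert)
    also have "\<dots> = (\<Sum>j\<in>UNIV. (\<omega> $ (Some ` {i, j}) * \<alpha> j) *\<^sub>R (p $ i - p $ j))"
      unfolding last scaleR_sum_left sum.distrib[symmetric]
      by (rule sum.cong) (simp_all add: algebra_simps del: image_insert)
    finally have "\<alpha> i *\<^sub>R (\<Sum>j\<in>UNIV. (\<omega> $ (Some ` {i, j}) * \<alpha> j) *\<^sub>R (p $ i - p $ j)) = 0" by simp
    then show ?thesis
      unfolding scaled scaleR_sum_right by (simp add: mult_ac del: image_insert)
  qed
  then show "?\<omega> \<in> euclidean_stresses E p"
    using off' by (simp only: euclidean_stresses_iff) simp
  then have lift: "lift_stress ?\<omega> \<in> hyperbolic_stresses E q" by (rule lift_stress_in)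
  have radial: "radial_stress ?\<omega> i = \<omega> $ {Some i, None}" for i
  proof -
    have "radial_stress ?\<omega> i = (\<Sum>j\<in>UNIV. \<omega> $ (Some ` {i, j}) * (\<alpha> j - \<alpha> i)) / \<alpha> i"
      unfolding radial_stress_def scaled
      by (intro arg_cong[where f = "\<lambda>s. s / \<alpha> i"] sum.cong) (simp_all add: field_simps)
    then show ?thesis unfolding last[symmetric] by simp
  qed
  show "lift_stress ?\<omega> = \<omega>"
  proof (rule vec_eq_iff[THEN iffD2], rule allI)
    fix e
    show "lift_stress ?\<omega> $ e = \<omega> $ e"
    proof (cases "e \<in> cone_edges E")
      case True
      then consider e' where "e = Some ` e'" | i where "e = {Some i, None}"
        by (auto simp: cone_edges_def insert_commute)
      then show ?thesis by cases (simp_all add: radial)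
    next
      case False
      then show ?thesis using lift off by (auto simp: hyperbolic_stresses_iff)
    qed
  qed
qed

lemma euclidean_symmetric_stress_iff:
  "symmetric_stress S E p \<omega> \<longleftrightarrow> (\<forall>x\<in>S. \<forall>e\<in>E. \<omega> $ (\<phi> x ` e) = \<omega> $ e)"
  by (auto simp: symmetric_stress_def edge_orbit_def action)

lemma hyperbolic_symmetric_stress_iff:
  "symmetric_stress (star ` S) (cone_edges E) (cone_config q) \<omega> \<longleftrightarrow>
    (\<forall>x\<in>S. (\<forall>e\<in>E. \<omega> $ (Some ` \<phi> x ` e) = \<omega> $ (Some ` e))
       \<and> (\<forall>i. \<omega> $ {Some (\<phi> x i), None} = \<omega> $ {Some i, None}))"
proof -
  have "map_option f ` Some ` e = Some ` f ` e" for f :: "'v \<Rightarrow> 'v" and e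
    by (auto simp: image_image)
  then show ?thesis
    by (simp add: symmetric_stress_def edge_orbit_def cone_action ball_cone_edges insert_commute)
       blast
qed

lemma lift_stress_symmetric_iff:
  assumes "\<forall>e. e \<notin> E \<longrightarrow> \<omega> $ e = 0"
  shows "symmetric_stress (star ` S) (cone_edges E) (cone_config q) (lift_stress \<omega>)
    \<longleftrightarrow> symmetric_stress S E p \<omega>"
proof -
  have prod: "(\<Prod>i\<in>\<phi> x ` e. \<alpha> i) = (\<Prod>i\<in>e. \<alpha> i)" if "x \<in> S" for x e
    using that bij_\<phi>[OF that] by (subst prod.reindex) (auto simp: bij_def inj_on_def)
  have radial: "radial_stress \<omega> (\<phi> x i) = radial_stress \<omega> i"
    if x: "x \<in> S" and "\<forall>e\<in>E. \<omega> $ (\<phi> x ` e) = \<omega> $ e" for x i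
  proof -
    have inv: "\<omega> $ {\<phi> x i, \<phi> x j} = \<omega> $ {i, j}" for i j
    proof (cases "{i, j} \<in> E")
      case True
      then show ?thesis using that(2) by force
    next
      case False
      then have "{\<phi> x i, \<phi> x j} \<notin> E" using aut[OF x] by (simp add: graph_aut_def)
      then show ?thesis using assms False by simp
    qed
    have "(\<Sum>j\<in>UNIV. \<omega> $ {\<phi> x i, j} * (1 / \<alpha> (\<phi> x i) - 1 / \<alpha> j))
        = (\<Sum>j\<in>UNIV. \<omega> $ {\<phi> x i, \<phi> x j} * (1 / \<alpha> (\<phi> x i) - 1 / \<alpha> (\<phi> x j)))"
      by (rule sum.reindex_bij_betw[symmetric]) (use bij_\<phi>[OF x] in simp)
    then show ?thesis by (simp add: radial_stress_def inv x)
  qed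
  show ?thesis
    unfolding hyperbolic_symmetric_stress_iff euclidean_symmetric_stress_iff
    by (auto simp: prod radial simp del: image_insert)
qed

lemma subspace_euclidean_stresses:
  "subspace {\<omega> \<in> euclidean_stresses E p. symmetric_stress S E p \<omega>}"
  unfolding subspace_def euclidean_symmetric_stress_iff euclidean_stresses_iff
  by (auto simp: scaleR_add_left sum.distrib simp flip: scaleR_scaleR scaleR_sum_right)

lemma isomorphic_stresses:
  "isomorphic_subspaces {\<omega> \<in> euclidean_stresses E p. symmetric_stress S E p \<omega>}
     {\<omega> \<in> hyperbolic_stresses E q.
        symmetric_stress (star ` S) (cone_edges E) (cone_config q) \<omega>}"
proof (rule isomorphic_subspacesI[where f = lift_stress and g = project_stress,
      OF subspace_euclidean_stresses linear_lift_stress], goal_cases)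
  case (1 \<omega>)
  then show ?case by (auto simp: lift_stress_in lift_stress_symmetric_iff euclidean_stresses_iff)
next
  case (2 \<omega>)
  then show ?case
    using hyperbolic_stressD[of \<omega>] lift_stress_symmetric_iff[of "project_stress \<omega>"]
    by (simp add: euclidean_stresses_iff)
qed (auto simp: project_lift_stress hyperbolic_stressD)

end

section \<open>The comparison theorem\<close>

text \<open>
  Since \<open>x\<^sup>*\<close> preserves the last coordinate, the joint to which it sends \<open>q i\<close> has the height of \<open>q i\<close>
  and lies over \<open>x (p i)\<close>.
\<close>

lemma central_projection_vertex_action:
  assumes p: "framework E p" and \<Phi>: "x (p $ i) = p $ \<Phi> i"
    and q: "\<And>i. q $ i = \<alpha> i *\<^sub>R (p $ i, 1)" and nz: "\<And>i. \<alpha> i \<noteq> 0"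
    and lin: "linear x"
    and \<Psi>: "star x (cone_config q $ Some i) = cone_config q $ \<Psi> (Some i)"
  shows "\<Psi> (Some i) = Some (\<Phi> i)" "\<alpha> (\<Phi> i) = \<alpha> i"
proof -
  have img: "cone_config q $ \<Psi> (Some i) = (\<alpha> i *\<^sub>R p $ \<Phi> i, \<alpha> i)"
    using \<Psi> \<Phi> by (simp add: q star_def linear_cmul[OF lin])
  then obtain j where j: "\<Psi> (Some i) = Some j"
    using nz[of i] by (cases "\<Psi> (Some i)") (auto simp: prod_eq_iff)
  then have "\<alpha> j = \<alpha> i" "p $ j = p $ \<Phi> i" using img nz by (auto simp: q)
  then show "\<Psi> (Some i) = Some (\<Phi> i)" "\<alpha> (\<Phi> i) = \<alpha> i"
    using p j by (auto simp: framework_def dest: injD)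
qed

lemma central_projectionI:
  fixes S :: "(real ^ 'd \<Rightarrow> real ^ 'd) set" and p :: "(real ^ 'd) ^ 'v::finite"
  assumes S: "subgroup S orthogonal_group"
    and p: "p \<in> symmetric_frameworks S E"
    and q: "cone_config q \<in> symmetric_frameworks (star ` S) (cone_edges E)"
    and proj: "projects_to q p"
  shows "central_projection S E p q (\<lambda>i. snd (q $ i)) (vertex_action E p)"
proof -
  let ?\<alpha> = "\<lambda>i. snd (q $ i)"
  have q_eq: "q $ i = ?\<alpha> i *\<^sub>R (p $ i, 1)" and nz: "?\<alpha> i \<noteq> 0" for i
  proof -
    obtain a where "a \<noteq> 0" "q $ i = a *\<^sub>R (p $ i, 1)"
      using proj by (auto simp: projects_to_def)
    then show "q $ i = ?\<alpha> i *\<^sub>R (p $ i, 1)" "?\<alpha> i \<noteq> 0" by simp_all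
  qed
  have orth: "orthogonal_transformation x" if "x \<in> S" for x
    using subgroup.subset[OF S] that by (auto simp: orthogonal_group_def)
  obtain \<Phi> where fp: "framework E p" and \<Phi>: "\<Phi> \<in> S \<rightarrow> graph_aut E"
      "\<forall>x\<in>S. \<forall>i. x (p $ i) = p $ \<Phi> x i"
    using p by (auto simp: symmetric_frameworks_def)
  obtain \<Psi> where fq: "framework (cone_edges E) (cone_config q)"
    and \<Psi>: "\<Psi> \<in> star ` S \<rightarrow> graph_aut (cone_edges E)"
      "\<forall>y\<in>star ` S. \<forall>k. y (cone_config q $ k) = cone_config q $ \<Psi> y k"
    using q by (auto simp: symmetric_frameworks_def)
  have act: "vertex_action E p x = \<Phi> x" if "x \<in> S" for x
    using vertex_action_eq[OF fp \<Phi> that] .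
  have key: "\<Psi> (star x) (Some i) = Some (\<Phi> x i)" "?\<alpha> (\<Phi> x i) = ?\<alpha> i" if x: "x \<in> S" for x i
  proof -
    note * = central_projection_vertex_action[where \<alpha> = ?\<alpha> and x = x and i = i and \<Phi> = "\<Phi> x"
        and \<Psi> = "\<Psi> (star x)" and q = q, OF fp _ q_eq nz orthogonal_transformation_linear[OF orth[OF x]]]
    show "\<Psi> (star x) (Some i) = Some (\<Phi> x i)" "?\<alpha> (\<Phi> x i) = ?\<alpha> i"
      using * \<Phi>(2) \<Psi>(2) x by blast+
  qed
  have "\<Psi> (star x) None = None" if x: "x \<in> S" for x
  proof -
    have "cone_config q $ \<Psi> (star x) None = star x 0"
      using \<Psi>(2) x by (metis cone_config_simps(1) imageI)
    also have "\<dots> = 0"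
      using linear_0[OF orthogonal_transformation_linear[OF orth[OF x]]]
      by (simp add: star_def prod_eq_iff)
    finally show ?thesis
      using nz by (cases "\<Psi> (star x) None") (auto simp: prod_eq_iff)
  qed
  then have "\<Psi> (star x) = map_option (\<Phi> x)" if "x \<in> S" for x
    using key(1)[OF that] that by (intro ext) (metis not_None_eq option.simps(8,9))
  then have cone_act: "vertex_action (cone_edges E) (cone_config q) (star x) = map_option (\<Phi> x)"
    if "x \<in> S" for x
    using vertex_action_eq[OF fq \<Psi>, of "star x"] that by simp
  show ?thesis
  proof
    show "simple_graph E" using fp by (simp add: framework_def)
    fix x i assume "x \<in> S"
    then show "vertex_action E p x \<in> graph_aut E" "x (p $ i) = p $ vertex_action E p x i"
        "vertex_action (cone_edges E) (cone_config q) (star x) = map_option (vertex_action E p x)"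
        "?\<alpha> (vertex_action E p x i) = ?\<alpha> i"
      using \<Phi> cone_act key(2) by (auto simp: act)
  qed (rule refl orth q_eq nz | assumption)+
qed

theorem theorem5p4:
  fixes S :: "(real ^ 'd \<Rightarrow> real ^ 'd) set"
    and E :: "'v::finite set set"
    and p :: "(real ^ 'd) ^ 'v"
    and q :: "((real ^ 'd) \<times> real) ^ 'v"
  assumes "subgroup S orthogonal_group"
    and "p \<in> symmetric_frameworks S E"
    and "\<forall>i. q $ i \<in> hyperbolic_space"
    and "cone_config q \<in> symmetric_frameworks (star ` S) (cone_edges E)"
    and "projects_to q p"
  shows "isomorphic_subspaces
           {u \<in> euclidean_motions E p. symmetric_motion S E p u}
           {u \<in> hyperbolic_motions E q. symmetric_motion (star ` S) (cone_edges E) (cone_config q) u}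
       \<and> isomorphic_subspaces
           {u \<in> euclidean_trivial_motions E p. symmetric_motion S E p u}
           {u \<in> hyperbolic_trivial_motions E q.
              symmetric_motion (star ` S) (cone_edges E) (cone_config q) u}
       \<and> ((\<exists>u \<in> euclidean_motions E p.
              symmetric_motion S E p u \<and> u \<notin> euclidean_trivial_motions E p)
          \<longleftrightarrow> (\<exists>u \<in> hyperbolic_motions E q.
              symmetric_motion (star ` S) (cone_edges E) (cone_config q) u
              \<and> u \<notin> hyperbolic_trivial_motions E q))
       \<and> isomorphic_subspaces
           {\<omega> \<in> euclidean_stresses E p. symmetric_stress S E p \<omega>}
           {\<omega> \<in> hyperbolic_stresses E q.
              symmetric_stress (star ` S) (cone_edges E) (cone_config q) \<omega>}"
proof -
  interpret central_projection S E p q "\<lambda>i. snd (q $ i)" "vertex_action E p"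
    by (rule central_projectionI) fact+
  show ?thesis
    using isomorphic_motions isomorphic_trivial_motions nontrivial_motion_iff isomorphic_stresses
    by blast
qed

end
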